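(* Let $A\in\mathbb{R}_+^{\infty\times\infty}$ with $r_{ess}(A)<r(A)$. Then the functions $r(\cdot)$ and $\mu(\cdot)$ on $(\mathbb{R}_+^{\infty\times\infty},d)$ are continuous at $A$.
   Context: $\mathbb{R}_+^{\infty\times\infty}$ is the set of infinite matrices $A=(a_{ij})_{i,j\in\mathbb{N}}$ with non-negative real entries and $\|A\|:=\sup\{a_{ij}:i,j\in\mathbb{N}\}<\infty$ ($\mathbb{N}=\{1,2,\dots\}$), with the metric $d(A,B)=\|A-B\|=\sup\{|a_{ij}-b_{ij}|:i,j\in\mathbb{N}\}$. The max-algebra product is $(A\otimes B)_{ij}=\sup_{k\in\mathbb{N}}a_{ik}b_{kj}$, and $A^k_\otimes$ is the $k$-th power of $A$ for $\otimes$. The max-algebra spectral radius is $r(A)=\lim_{k\to\infty}\|A^k_\otimes\|^{1/k}=\inf_k\|A^k_\otimes\|^{1/k}$ (the limit exists). For $n\in\mathbb{N}$, $P_n(x_1,x_2,\dots)=(0,\dots,0,x_{n+1},x_{n+2},\dots)$ (first $n$ coordinates replaced by $0$), so $P_nAP_n$ is $A$ with all entries having row or column index $\le n$ replaced by $0$; $r_{ess}(A)=\lim_{n\to\infty}r(P_nAP_n)=\inf_{n}r(P_nAP_n)$. For $i_0,\dots,i_k\in\mathbb{N}$ put $A(i_k,\dots,i_0)=\prod_{t=0}^{k-1}a_{i_{t+1}i_t}$, and define $\mu(A)=\sup\{A(i_1,i_k,\dots,i_2,i_1)^{1/k}:k\in\mathbb{N},\ i_1,\dots,i_k\in\mathbb{N}\}$.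 *)

theory Defs
  imports "HOL-Analysis.Analysis"
begin

text \<open>
  Infinite matrices are functions \<open>nat \<Rightarrow> nat \<Rightarrow> real\<close>. The index set \<open>{1, 2, \<dots>}\<close> is
  shifted to \<open>{0, 1, \<dots>}\<close>: \<open>A i j\<close> stands for the entry in row \<open>i + 1\<close> and column
  \<open>j + 1\<close>, so the first \<open>n\<close> coordinates are those with index \<open>< n\<close>.
\<close>

type_synonym inf_mat = "nat \<Rightarrow> nat \<Rightarrow> real"

definition nonneg_bdd_mats :: "inf_mat set" where
  "nonneg_bdd_mats = {A. (\<forall>i j. 0 \<le> A i j) \<and> bdd_above {A i j | i j. True}}"

definition mat_norm :: "inf_mat \<Rightarrow> real" where
  "mat_norm A = Sup {A i j | i j. True}"

text \<open>
  The locale \<open>Metric_space\<close> requires non-negativity of the distance also outside the carrier,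
  where the supremum may fail to exist; hence the default value \<open>0\<close> there.
\<close>

definition mat_dist :: "inf_mat \<Rightarrow> inf_mat \<Rightarrow> real" where
  "mat_dist A B =
    (if A \<in> nonneg_bdd_mats \<and> B \<in> nonneg_bdd_mats
     then Sup {\<bar>A i j - B i j\<bar> | i j. True} else 0)"

lemma mat_dist_bdd:
  assumes "A \<in> nonneg_bdd_mats" "B \<in> nonneg_bdd_mats"
  shows "bdd_above {\<bar>A i j - B i j\<bar> | i j. True}"
proof -
  obtain a b where a: "\<And>i j. A i j \<le> a" and b: "\<And>i j. B i j \<le> b"
    using assms unfolding nonneg_bdd_mats_def bdd_above_def by blast
  have "\<bar>A i j - B i j\<bar> \<le> a + b" for i j
  proof -
    have "0 \<le> A i j" "0 \<le> B i j"
      using assms by (auto simp: nonneg_bdd_mats_def)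
    then show ?thesis
      using a[of i j] b[of i j] by linarith
  qed
  then show ?thesis
    by (intro bdd_aboveI[where M = "a + b"]) auto
qed

lemma mat_dist_upper:
  assumes "A \<in> nonneg_bdd_mats" "B \<in> nonneg_bdd_mats"
  shows "\<bar>A i j - B i j\<bar> \<le> mat_dist A B"
proof -
  have "\<bar>A i j - B i j\<bar> \<le> Sup {\<bar>A i j - B i j\<bar> | i j. True}"
    by (rule cSup_upper) (use mat_dist_bdd[OF assms] in auto)
  then show ?thesis using assms by (simp add: mat_dist_def)
qed

lemma mat_dist_least:
  assumes "A \<in> nonneg_bdd_mats" "B \<in> nonneg_bdd_mats"
    and "\<And>i j. \<bar>A i j - B i j\<bar> \<le> c"
  shows "mat_dist A B \<le> c"
proof -
  have "Sup {\<bar>A i j - B i j\<bar> | i j. True} \<le> c"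
    by (rule cSup_least) (use assms in auto)
  then show ?thesis using assms by (simp add: mat_dist_def)
qed

lemma Metric_space_nonneg_bdd_mats: "Metric_space nonneg_bdd_mats mat_dist"
proof
  show "0 \<le> mat_dist A B" for A B
  proof (cases "A \<in> nonneg_bdd_mats \<and> B \<in> nonneg_bdd_mats")
    case True
    then show ?thesis
      using mat_dist_upper[of A B 0 0] by simp
  qed (auto simp: mat_dist_def)
  show "mat_dist A B = mat_dist B A" for A B
    by (simp add: mat_dist_def abs_minus_commute)
next
  fix A B assume AB: "A \<in> nonneg_bdd_mats" "B \<in> nonneg_bdd_mats"
  show "mat_dist A B = 0 \<longleftrightarrow> A = B"
  proof
    assume "mat_dist A B = 0"
    then have "A i j = B i j" for i j
      using mat_dist_upper[OF AB, of i j] by simp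
    then show "A = B" by blast
  next
    assume "A = B"
    then have "mat_dist A B \<le> 0"
      using mat_dist_least[OF AB, of 0] by simp
    moreover have "0 \<le> mat_dist A B"
      using mat_dist_upper[OF AB, of 0 0] by simp
    ultimately show "mat_dist A B = 0" by simp
  qed
next
  fix A B C
  assume A: "A \<in> nonneg_bdd_mats" and B: "B \<in> nonneg_bdd_mats" and C: "C \<in> nonneg_bdd_mats"
  show "mat_dist A C \<le> mat_dist A B + mat_dist B C"
  proof (rule mat_dist_least[OF A C])
    show "\<bar>A i j - C i j\<bar> \<le> mat_dist A B + mat_dist B C" for i j
      using mat_dist_upper[OF A B, of i j] mat_dist_upper[OF B C, of i j] by linarith
  qed
qed

definition mat_topology :: "inf_mat topology" where
  "mat_topology = Metric_space.mtopology nonneg_bdd_mats mat_dist"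

lemma topspace_mat_topology [simp]: "topspace mat_topology = nonneg_bdd_mats"
  unfolding mat_topology_def
  by (rule Metric_space.topspace_mtopology[OF Metric_space_nonneg_bdd_mats])

definition max_mult :: "inf_mat \<Rightarrow> inf_mat \<Rightarrow> inf_mat"  (infixl "\<otimes>\<^sub>m" 70) where
  "(A \<otimes>\<^sub>m B) = (\<lambda>i j. SUP k. A i k * B k j)"

text \<open>The zeroth power is the neutral element of the max-product on non-negative matrices.\<close>

primrec max_pow :: "inf_mat \<Rightarrow> nat \<Rightarrow> inf_mat" where
  "max_pow A 0 = (\<lambda>i j. if i = j then 1 else 0)"
| "max_pow A (Suc k) = max_pow A k \<otimes>\<^sub>m A"

definition spec_rad :: "inf_mat \<Rightarrow> real" where
  "spec_rad A = lim (\<lambda>k. root k (mat_norm (max_pow A k)))"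

text \<open>\<open>compress n A\<close> is \<open>P\<^sub>n A P\<^sub>n\<close>.\<close>

definition compress :: "nat \<Rightarrow> inf_mat \<Rightarrow> inf_mat" where
  "compress n A = (\<lambda>i j. if i < n \<or> j < n then 0 else A i j)"

definition ess_spec_rad :: "inf_mat \<Rightarrow> real" where
  "ess_spec_rad A = lim (\<lambda>n. spec_rad (compress n A))"

text \<open>
  \<open>path_weight A k p\<close> is \<open>A(p k, \<dots>, p 1, p 0)\<close>; only the values of \<open>p\<close> on \<open>{0..k}\<close> matter.
  With \<open>p t\<close> for \<open>i\<^bsub>t+1\<^esub>\<close> (\<open>t < k\<close>) and \<open>p k = p 0\<close>, this is the weight
  \<open>A(i\<^sub>1, i\<^sub>k, \<dots>, i\<^sub>2, i\<^sub>1)\<close> of a closed walk of length \<open>k\<close>.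
\<close>

definition path_weight :: "inf_mat \<Rightarrow> nat \<Rightarrow> (nat \<Rightarrow> nat) \<Rightarrow> real" where
  "path_weight A k p = (\<Prod>t<k. A (p (Suc t)) (p t))"

definition max_cycle_mean :: "inf_mat \<Rightarrow> real" where
  "max_cycle_mean A = Sup {root k (path_weight A k p) | k p. 1 \<le> k \<and> p k = p 0}"

end

theory Submission
  imports Defs
begin

text \<open>
  The spectral radius \<open>r\<close> is an infimum of continuous functions, hence upper semicontinuous; \<open>\<mu>\<close> is a
  supremum of continuous functions, hence lower semicontinuous; and \<open>\<mu> \<le> r\<close> everywhere. So both are
  continuous at every \<open>A\<close> with \<open>\<mu> A = r A\<close>. If the essential spectral radius and \<open>\<mu> A\<close> were both
  smaller than some \<open>c < r A\<close>, walks avoiding the first \<open>n\<close> indices would have weight \<open>O(c^k)\<close>.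
  Allowing one further index \<open>v\<close> preserves this: cut a walk at its first and last visit to \<open>v\<close>; the
  middle piece is closed, so of weight at most \<open>c\<close> to its length. After \<open>n\<close> steps all walks are
  \<open>O(c^k)\<close>, contradicting \<open>c < r A\<close>.
\<close>

section \<open>Submultiplicative sequences\<close>

text \<open>Write \<open>k = q * m + s\<close> with \<open>s < m\<close>. Each of the
  \<open>q\<close> blocks costs a factor at most \<open>x ^ m\<close>, and the finitely many
  remainders go into the constant.\<close>

lemma submultiplicative_bound:
  fixes f :: "nat \<Rightarrow> real"
  assumes nonneg: "\<And>k. 0 \<le> f k" and submult: "\<And>m n. f (m + n) \<le> f m * f n"
    and x: "0 < x" and m: "0 < m" and fm: "f m \<le> x ^ m"
  obtains K where "0 < K" "\<And>k. f k \<le> K * x ^ k"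
proof
  \<comment> \<open>The sum dominates every ratio \<open>f s / x ^ s\<close>; the summand 1 keeps
    the constant positive even if all of these vanish.\<close>
  let ?K = "1 + (\<Sum>s<m. f s / x ^ s)"
  have "0 \<le> (\<Sum>s<m. f s / x ^ s)"
    using nonneg x by (intro sum_nonneg) simp
  then show "0 < ?K" by linarith
  have step: "f (q * m + s) \<le> x ^ (q * m) * f s" for q s
  proof (induction q)
    case (Suc q)
    have "f (Suc q * m + s) = f (m + (q * m + s))" by (simp add: algebra_simps)
    also have "\<dots> \<le> f m * f (q * m + s)" by (rule submult)
    also have "\<dots> \<le> x ^ m * (x ^ (q * m) * f s)"
      by (intro mult_mono fm Suc.IH nonneg) (use x in simp)
    also have "\<dots> = x ^ (Suc q * m) * f s" by (simp add: power_add)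
    finally show ?case .
  qed simp
  show "f k \<le> ?K * x ^ k" for k
  proof -
    let ?s = "k mod m" and ?q = "k div m"
    have k: "?q * m + ?s = k" by simp
    have "f k \<le> x ^ (?q * m) * f ?s" using step[of ?q ?s] by simp
    also have "\<dots> = x ^ (?q * m + ?s) * (f ?s / x ^ ?s)"
      unfolding power_add using x by simp
    also have "\<dots> = x ^ k * (f ?s / x ^ ?s)" unfolding k ..
    also have "f ?s / x ^ ?s \<le> (\<Sum>s<m. f s / x ^ s)"
      by (rule member_le_sum) (use m nonneg x in auto)
    then have "x ^ k * (f ?s / x ^ ?s) \<le> x ^ k * ?K"
      by (intro mult_left_mono) (use x in auto)
    finally show ?thesis by (simp add: mult.commute)
  qed
qed

text \<open>Fekete's lemma in multiplicative form. The index 0 is left out of the infimum because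
  \<open>root 0\<close> is constantly 0.\<close>

lemma submultiplicative_root_LIMSEQ:
  fixes f :: "nat \<Rightarrow> real"
  assumes nonneg: "\<And>k. 0 \<le> f k" and submult: "\<And>m n. f (m + n) \<le> f m * f n"
  shows "(\<lambda>k. root k (f k)) \<longlonglongrightarrow> Inf ((\<lambda>k. root k (f k)) ` {0<..})"
proof (rule order_tendstoI)
  let ?S = "(\<lambda>k. root k (f k)) ` {0<..}"
  have bdd: "bdd_below ?S"
    by (rule bdd_belowI[where m = 0]) (use nonneg in auto)
  have L: "Inf ?S \<le> root k (f k)" if "0 < k" for k
    by (rule cInf_lower) (use bdd that in auto)
  have L0: "0 \<le> Inf ?S"
    by (rule cInf_greatest) (use nonneg in auto)
  show "\<forall>\<^sub>F k in sequentially. a < root k (f k)" if "a < Inf ?S" for a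
    using eventually_gt_at_top[of 0] by eventually_elim (use less_le_trans[OF that L] in blast)
  show "\<forall>\<^sub>F k in sequentially. root k (f k) < a" if a: "Inf ?S < a" for a
  proof -
    \<comment> \<open>The gap between \<open>x\<close> and \<open>a\<close> leaves room for the
      factor \<open>root k K\<close>, which tends to 1.\<close>
    obtain x where x: "Inf ?S < x" "x < a" using dense[OF a] by blast
    have x0: "0 < x" using L0 x by linarith
    obtain m where m: "0 < m" "root m (f m) < x"
      using x(1) cInf_less_iff[OF _ bdd] by auto
    have "f m = root m (f m) ^ m" using m nonneg by simp
    also have "\<dots> \<le> x ^ m"
      by (intro power_mono) (use m nonneg in auto)
    finally obtain K where K: "0 < K" "\<And>k. f k \<le> K * x ^ k"
      using submultiplicative_bound[of f x m, OF nonneg submult x0 m(1)] by blast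
    have "(\<lambda>k. root k K * x) \<longlonglongrightarrow> 1 * x"
      by (intro tendsto_intros LIMSEQ_root_const K)
    then have "\<forall>\<^sub>F k in sequentially. root k K * x < a"
      by (rule order_tendstoD) (use x in simp)
    then show ?thesis using eventually_gt_at_top[of 0]
    proof eventually_elim
      case (elim k)
      have "root k (f k) \<le> root k (K * x ^ k)" using elim K by simp
      also have "\<dots> = root k K * x"
        using elim x0 by (simp add: real_root_mult real_root_power_cancel)
      finally show ?case using elim by simp
    qed
  qed
qed

section \<open>Walks and powers\<close>

lemma nonneg_bdd_matsI:
  assumes "\<And>i j. 0 \<le> A i j" "\<And>i j. A i j \<le> b"
  shows "A \<in> nonneg_bdd_mats"
  using assms unfolding nonneg_bdd_mats_def bdd_above_def by blast

lemma mat_nonneg: "A \<in> nonneg_bdd_mats \<Longrightarrow> 0 \<le> A i j"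
  by (simp add: nonneg_bdd_mats_def)

lemma mat_norm_upper: "A \<in> nonneg_bdd_mats \<Longrightarrow> A i j \<le> mat_norm A"
  unfolding mat_norm_def nonneg_bdd_mats_def by (intro cSup_upper) auto

lemma mat_norm_least: "(\<And>i j. A i j \<le> c) \<Longrightarrow> mat_norm A \<le> c"
  unfolding mat_norm_def by (rule cSup_least) auto

lemma mat_norm_nonneg: "A \<in> nonneg_bdd_mats \<Longrightarrow> 0 \<le> mat_norm A"
  using mat_nonneg[of A 0 0] mat_norm_upper[of A 0 0] by linarith

lemma max_mult_bound:
  assumes "A \<in> nonneg_bdd_mats" "B \<in> nonneg_bdd_mats"
  shows "A i k * B k j \<le> mat_norm A * mat_norm B"
  by (intro mult_mono mat_norm_upper mat_norm_nonneg mat_nonneg assms)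

lemma max_mult_upper:
  assumes "A \<in> nonneg_bdd_mats" "B \<in> nonneg_bdd_mats"
  shows "A i k * B k j \<le> (A \<otimes>\<^sub>m B) i j"
  unfolding max_mult_def
  by (rule cSUP_upper) (auto intro!: bdd_aboveI2 max_mult_bound assms)

lemma max_mult_nonneg_bdd:
  assumes "A \<in> nonneg_bdd_mats" "B \<in> nonneg_bdd_mats"
  shows "A \<otimes>\<^sub>m B \<in> nonneg_bdd_mats"
proof (rule nonneg_bdd_matsI)
  show "0 \<le> (A \<otimes>\<^sub>m B) i j" for i j
    using max_mult_upper[OF assms, of i 0 j] mat_nonneg[OF assms(1), of i 0]
      mat_nonneg[OF assms(2), of 0 j] by (meson mult_nonneg_nonneg order_trans)
  show "(A \<otimes>\<^sub>m B) i j \<le> mat_norm A * mat_norm B" for i j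
    unfolding max_mult_def by (rule cSUP_least) (auto intro: max_mult_bound assms)
qed

lemma max_pow_nonneg_bdd: "A \<in> nonneg_bdd_mats \<Longrightarrow> max_pow A k \<in> nonneg_bdd_mats"
proof (induction k)
  case 0
  show ?case by (rule nonneg_bdd_matsI[where b = 1]) auto
qed (auto intro: max_mult_nonneg_bdd)

section \<open>Weights of walks and their relation to the max-powers\<close>

lemma path_weight_0 [simp]: "path_weight A 0 p = 1"
  by (simp add: path_weight_def)

lemma path_weight_1 [simp]: "path_weight A (Suc 0) p = A (p (Suc 0)) (p 0)"
  by (simp add: path_weight_def)

lemma path_weight_add:
  "path_weight A (m + n) p = path_weight A m p * path_weight A n (\<lambda>t. p (m + t))"
  unfolding path_weight_def by (induction n) (auto simp: mult.assoc)

lemma path_weight_nonneg: "A \<in> nonneg_bdd_mats \<Longrightarrow> 0 \<le> path_weight A k p"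
  unfolding path_weight_def by (intro prod_nonneg) (auto simp: mat_nonneg)

text \<open>Walks run from column index to row index, and \<open>max_pow\<close> multiplies by
  \<open>A\<close> on the right, so the induction peels off the first step of the walk.\<close>

lemma path_weight_le_max_pow:
  assumes "A \<in> nonneg_bdd_mats"
  shows "path_weight A k p \<le> max_pow A k (p k) (p 0)"
proof (induction k arbitrary: p)
  case (Suc k)
  let ?q = "\<lambda>t. p (Suc t)"
  have "path_weight A (Suc k) p = path_weight A k ?q * A (p 1) (p 0)"
    using path_weight_add[of A 1 k p] by simp
  also have "\<dots> \<le> max_pow A k (?q k) (?q 0) * A (p 1) (p 0)"
    by (intro mult_right_mono Suc.IH mat_nonneg assms)
  also have "\<dots> \<le> max_pow A (Suc k) (p (Suc k)) (p 0)"
    using max_mult_upper[OF max_pow_nonneg_bdd[OF assms] assms] by simp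
  finally show ?case .
qed simp

text \<open>With the preceding bound, entries of powers become suprema of walk weights. The
  induction varies \<open>W\<close>, since removing the first step rescales it.
  \<open>0 \<le> W\<close> covers \<open>k = 0\<close> with \<open>i \<noteq> j\<close>, where no
  walk exists and the entry is 0.\<close>

lemma max_pow_le:
  assumes A: "A \<in> nonneg_bdd_mats" and W: "0 \<le> W"
    and "\<And>p. p k = i \<Longrightarrow> p 0 = j \<Longrightarrow> path_weight A k p \<le> W"
  shows "max_pow A k i j \<le> W"
  using W assms(3)
proof (induction k arbitrary: j W)
  case 0
  show ?case using 0(1) 0(2)[of "\<lambda>_. i"] by auto
next
  case (Suc k)
  have "max_pow A k i l * A l j \<le> W" for l
  proof (cases "A l j = 0")
    case False
    then have pos: "0 < A l j" using mat_nonneg[OF A, of l j] by linarith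
    have "max_pow A k i l \<le> W / A l j"
    proof (rule Suc.IH)
      show "0 \<le> W / A l j" using Suc.prems(1) pos by simp
      fix p assume p: "p k = i" "p 0 = l"
      \<comment> \<open>\<open>case_nat j p\<close> is the walk \<open>p\<close> with
        \<open>j\<close> prepended as its starting index.\<close>
      have "path_weight A (Suc k) (case_nat j p) = A l j * path_weight A k p"
        using path_weight_add[of A 1 k "case_nat j p"] p by simp
      moreover have "path_weight A (Suc k) (case_nat j p) \<le> W"
        by (rule Suc.prems(2)) (use p in auto)
      ultimately show "path_weight A k p \<le> W / A l j"
        using pos by (simp add: field_simps)
    qed
    then show ?thesis using pos by (simp add: field_simps)
  qed (use Suc.prems in simp)
  then show ?case unfolding max_pow.simps max_mult_def by (intro cSUP_least) auto
qed

lemma path_weight_le_norm: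
  assumes "A \<in> nonneg_bdd_mats"
  shows "path_weight A k p \<le> mat_norm (max_pow A k)"
  using path_weight_le_max_pow[OF assms] mat_norm_upper[OF max_pow_nonneg_bdd[OF assms]]
  by (rule order_trans)

lemma norm_max_pow_le:
  assumes "A \<in> nonneg_bdd_mats" "\<And>p. path_weight A k p \<le> W"
  shows "mat_norm (max_pow A k) \<le> W"
proof -
  have "0 \<le> W" using path_weight_nonneg[OF assms(1)] assms(2) by (rule order_trans)
  then show ?thesis by (intro mat_norm_least max_pow_le assms)
qed

lemma norm_max_pow_nonneg: "A \<in> nonneg_bdd_mats \<Longrightarrow> 0 \<le> mat_norm (max_pow A k)"
  by (intro mat_norm_nonneg max_pow_nonneg_bdd)

text \<open>Cutting a walk after \<open>m\<close> steps gives submultiplicativity without passing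
  through associativity of the max-product.\<close>

lemma norm_max_pow_add:
  assumes "A \<in> nonneg_bdd_mats"
  shows "mat_norm (max_pow A (m + n)) \<le> mat_norm (max_pow A m) * mat_norm (max_pow A n)"
proof (rule norm_max_pow_le[OF assms])
  show "path_weight A (m + n) p \<le> mat_norm (max_pow A m) * mat_norm (max_pow A n)" for p
    unfolding path_weight_add
    by (intro mult_mono path_weight_le_norm path_weight_nonneg norm_max_pow_nonneg assms)
qed

section \<open>The spectral radius and the maximum cycle mean\<close>

text \<open>Fekete's lemma shows that the \<open>lim\<close> in the definition is a genuine limit
  and identifies it with the infimum.\<close>

lemma spec_rad_LIMSEQ:
  assumes "A \<in> nonneg_bdd_mats"
  shows "(\<lambda>k. root k (mat_norm (max_pow A k))) \<longlonglongrightarrow> spec_rad A"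
    and spec_rad_eq_Inf: "spec_rad A = Inf ((\<lambda>k. root k (mat_norm (max_pow A k))) ` {0<..})"
proof -
  have lim: "(\<lambda>k. root k (mat_norm (max_pow A k)))
      \<longlonglongrightarrow> Inf ((\<lambda>k. root k (mat_norm (max_pow A k))) ` {0<..})"
    by (intro submultiplicative_root_LIMSEQ norm_max_pow_nonneg norm_max_pow_add assms)
  then show eq: "spec_rad A = Inf ((\<lambda>k. root k (mat_norm (max_pow A k))) ` {0<..})"
    unfolding spec_rad_def by (rule limI)
  show "(\<lambda>k. root k (mat_norm (max_pow A k))) \<longlonglongrightarrow> spec_rad A"
    unfolding eq by (rule lim)
qed

lemma spec_rad_nonneg:
  assumes "A \<in> nonneg_bdd_mats"
  shows "0 \<le> spec_rad A"
  unfolding spec_rad_eq_Inf[OF assms]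
  by (rule cInf_greatest) (use norm_max_pow_nonneg[OF assms] in auto)

text \<open>By the infimum formula, a single power certifies an upper bound.\<close>

lemma spec_rad_le:
  assumes A: "A \<in> nonneg_bdd_mats" and m: "0 < m" and x: "0 \<le> x"
    and le: "mat_norm (max_pow A m) \<le> x ^ m"
  shows "spec_rad A \<le> x"
proof -
  have "spec_rad A \<le> root m (mat_norm (max_pow A m))"
    unfolding spec_rad_eq_Inf[OF A]
    by (rule cInf_lower) (use m norm_max_pow_nonneg[OF A] in \<open>auto intro!: bdd_belowI[where m = 0]\<close>)
  also have "\<dots> \<le> root m (x ^ m)" using m le by simp
  also have "\<dots> = x" using m x by (simp add: real_root_power_cancel)
  finally show ?thesis .
qed

lemma spec_rad_lessE:
  assumes A: "A \<in> nonneg_bdd_mats" and x: "spec_rad A < x"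
  obtains m where "0 < m" "mat_norm (max_pow A m) < x ^ m"
proof -
  have "bdd_below ((\<lambda>k. root k (mat_norm (max_pow A k))) ` {0<..})"
    by (rule bdd_belowI[where m = 0]) (use norm_max_pow_nonneg[OF A] in auto)
  then obtain m where m: "0 < m" "root m (mat_norm (max_pow A m)) < x"
    using x cInf_less_iff[of "(\<lambda>k. root k (mat_norm (max_pow A k))) ` {0<..}" x]
    unfolding spec_rad_eq_Inf[OF A] by auto
  have "mat_norm (max_pow A m) = root m (mat_norm (max_pow A m)) ^ m"
    using m norm_max_pow_nonneg[OF A] by simp
  also have "\<dots> < x ^ m"
    by (intro power_strict_mono) (use m norm_max_pow_nonneg[OF A] in auto)
  finally show ?thesis using that m by blast
qed

text \<open>Any rate above the spectral radius bounds all walks, with a constant uniform in length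
  and walk. \<open>spec_rad_le_of_bound\<close> is the converse: there the constant disappears
  because \<open>root k K\<close> tends to 1.\<close>

lemma spec_rad_less_boundE:
  assumes A: "A \<in> nonneg_bdd_mats" and x: "spec_rad A < x"
  obtains K where "0 < K" "\<And>k p. path_weight A k p \<le> K * x ^ k"
proof -
  obtain m where m: "0 < m" "mat_norm (max_pow A m) < x ^ m"
    using spec_rad_lessE[OF assms] .
  have x0: "0 < x" using spec_rad_nonneg[OF A] x by linarith
  obtain K where "0 < K" "\<And>k. mat_norm (max_pow A k) \<le> K * x ^ k"
    using submultiplicative_bound[of "\<lambda>k. mat_norm (max_pow A k)" x m,
      OF norm_max_pow_nonneg[OF A] norm_max_pow_add[OF A] x0 m(1)] m(2) by auto
  with that show ?thesis using path_weight_le_norm[OF A] order_trans by blast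
qed

lemma spec_rad_le_of_bound:
  assumes A: "A \<in> nonneg_bdd_mats" and x: "0 \<le> x" and K: "0 < K"
    and bound: "\<And>k p. path_weight A k p \<le> K * x ^ k"
  shows "spec_rad A \<le> x"
proof (rule tendsto_le)
  show "(\<lambda>k. root k K * x) \<longlonglongrightarrow> x"
    using tendsto_mult[OF LIMSEQ_root_const[OF K] tendsto_const[of x]] by simp
  show "(\<lambda>k. root k (mat_norm (max_pow A k))) \<longlonglongrightarrow> spec_rad A"
    by (rule spec_rad_LIMSEQ[OF A])
  show "\<forall>\<^sub>F k in sequentially. root k (mat_norm (max_pow A k)) \<le> root k K * x"
    using eventually_gt_at_top[of 0]
  proof eventually_elim
    case (elim k)
    have "root k (mat_norm (max_pow A k)) \<le> root k (K * x ^ k)"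
      using norm_max_pow_le[OF A bound] elim by simp
    also have "\<dots> = root k K * x"
      using elim x by (simp add: real_root_mult real_root_power_cancel)
    finally show ?case .
  qed
qed simp

lemma spec_rad_mono:
  assumes "A \<in> nonneg_bdd_mats" "B \<in> nonneg_bdd_mats" "\<And>i j. A i j \<le> B i j"
  shows "spec_rad A \<le> spec_rad B"
proof (rule field_le_epsilon)
  fix e :: real assume "0 < e"
  then obtain m where m: "0 < m" "mat_norm (max_pow B m) < (spec_rad B + e) ^ m"
    using spec_rad_lessE[OF assms(2), of "spec_rad B + e"] by auto
  have "path_weight A m p \<le> path_weight B m p" for p
    unfolding path_weight_def by (intro prod_mono) (auto simp: assms mat_nonneg)
  then have "mat_norm (max_pow A m) \<le> mat_norm (max_pow B m)"
    by (intro norm_max_pow_le assms) (use path_weight_le_norm[OF assms(2)] order_trans in blast)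
  then show "spec_rad A \<le> spec_rad B + e"
    using spec_rad_le[OF assms(1) m(1), of "spec_rad B + e"] m(2) spec_rad_nonneg[OF assms(2)]
      \<open>0 < e\<close> by linarith
qed

section \<open>Closed walks and the maximum cycle mean\<close>

lemma closed_path_power:
  assumes "p k = p 0"
  shows "path_weight A (q * k) (\<lambda>t. p (t mod k)) = path_weight A k p ^ q"
proof (induction q)
  case (Suc q)
  have "path_weight A k (\<lambda>t. p (t mod k)) = path_weight A k p"
    unfolding path_weight_def
  proof (intro prod.cong refl)
    fix t assume "t \<in> {..<k}"
    then show "A (p (Suc t mod k)) (p (t mod k)) = A (p (Suc t)) (p t)"
      \<comment> \<open>Only the last step wraps around, to index 0; there closedness of
        \<open>p\<close> is used.\<close>
      using assms by (cases "Suc t = k") auto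
  qed
  then show ?case
    using path_weight_add[of A k "q * k" "\<lambda>t. p (t mod k)"] Suc.IH by simp
qed simp

text \<open>Traverse the closed walk \<open>q\<close> times: a mean above \<open>x\<close> would
  make the weight outgrow \<open>K * x ^ (q * k)\<close> for large \<open>q\<close>.\<close>

lemma closed_path_le_spec_rad:
  assumes A: "A \<in> nonneg_bdd_mats" and k: "0 < k" and p: "p k = p 0"
  shows "root k (path_weight A k p) \<le> spec_rad A"
proof (rule ccontr)
  assume "\<not> ?thesis"
  then obtain x where x: "spec_rad A < x" "x < root k (path_weight A k p)"
    using dense by (meson not_le)
  have x0: "0 < x" using spec_rad_nonneg[OF A] x by linarith
  obtain K where K: "0 < K" "\<And>k p. path_weight A k p \<le> K * x ^ k"
    using spec_rad_less_boundE[OF A x(1)] by blast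
  have "x ^ k < root k (path_weight A k p) ^ k"
    by (intro power_strict_mono) (use x x0 k in auto)
  then have "1 < path_weight A k p / x ^ k"
    using k x0 path_weight_nonneg[OF A] by simp
  then obtain q where q: "K < (path_weight A k p / x ^ k) ^ q"
    using real_arch_pow by blast
  have "path_weight A k p ^ q \<le> K * x ^ (q * k)"
    using K(2)[of "q * k" "\<lambda>t. p (t mod k)"] closed_path_power[OF p] by simp
  also have "x ^ (q * k) = (x ^ k) ^ q" by (simp add: power_mult[symmetric] mult.commute)
  finally show False using q x0 by (simp add: power_divide field_simps)
qed

lemma max_cycle_mean_bdd:
  assumes "A \<in> nonneg_bdd_mats"
  shows "bdd_above {root k (path_weight A k p) | k p. 1 \<le> k \<and> p k = p 0}"
  by (rule bdd_aboveI[where M = "spec_rad A"]) (use closed_path_le_spec_rad[OF assms] in auto)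

lemma max_cycle_mean_upper:
  assumes "A \<in> nonneg_bdd_mats" "0 < k" "p k = p 0"
  shows "root k (path_weight A k p) \<le> max_cycle_mean A"
  unfolding max_cycle_mean_def
  by (rule cSup_upper) (use assms max_cycle_mean_bdd in \<open>auto simp: Suc_le_eq\<close>)

lemma closed_walks_nonempty: "{root k (path_weight A k p) | k p. 1 \<le> k \<and> p k = p 0} \<noteq> {}"
  by (auto intro!: exI[of _ "1::nat"] exI[of _ "\<lambda>_. 0"])

lemma max_cycle_mean_le_spec_rad:
  assumes "A \<in> nonneg_bdd_mats"
  shows "max_cycle_mean A \<le> spec_rad A"
  unfolding max_cycle_mean_def
  by (rule cSup_least[OF closed_walks_nonempty]) (use closed_path_le_spec_rad[OF assms] in auto)

lemma less_max_cycle_meanE: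
  assumes "A \<in> nonneg_bdd_mats" "a < max_cycle_mean A"
  obtains k p where "0 < k" "p k = p 0" "a < root k (path_weight A k p)"
  using assms(2) less_cSup_iff[OF closed_walks_nonempty max_cycle_mean_bdd[OF assms(1)], of a]
  unfolding max_cycle_mean_def by (auto simp: Suc_le_eq)

text \<open>The root-free form also covers \<open>k = 0\<close>, which occurs below when an index is
  visited exactly once.\<close>

lemma closed_path_le_power:
  assumes A: "A \<in> nonneg_bdd_mats" and p: "p k = p 0" and c: "max_cycle_mean A \<le> c"
  shows "path_weight A k p \<le> c ^ k"
proof (cases "k = 0")
  case False
  then have "path_weight A k p = root k (path_weight A k p) ^ k"
    using path_weight_nonneg[OF A] by simp
  also have "\<dots> \<le> c ^ k"
    by (intro power_mono)
      (use False path_weight_nonneg[OF A] max_cycle_mean_upper[OF A _ p] c order_trans in auto)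
  finally show ?thesis .
qed simp

section \<open>Equality of the two quantities\<close>

lemma compress_nonneg_bdd:
  assumes "A \<in> nonneg_bdd_mats"
  shows "compress n A \<in> nonneg_bdd_mats"
  by (rule nonneg_bdd_matsI[where b = "mat_norm A"])
    (auto simp: compress_def mat_nonneg mat_norm_upper mat_norm_nonneg assms)

text \<open>Deleting more indices lowers entries, so the radii decrease and are bounded below by 0.
  Hence the defining \<open>lim\<close> is a genuine limit, and a value below \<open>c\<close> is
  reached.\<close>

lemma ess_spec_rad_lessE:
  assumes A: "A \<in> nonneg_bdd_mats" and less: "ess_spec_rad A < c"
  obtains n where "spec_rad (compress n A) < c"
proof -
  have "decseq (\<lambda>n. spec_rad (compress n A))"
    unfolding decseq_def
    by (intro allI impI spec_rad_mono compress_nonneg_bdd A)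
      (auto simp: compress_def mat_nonneg[OF A])
  then obtain L where "(\<lambda>n. spec_rad (compress n A)) \<longlonglongrightarrow> L"
    using decseq_convergent[of _ 0] spec_rad_nonneg[OF compress_nonneg_bdd[OF A]] by metis
  moreover from this have "L = ess_spec_rad A"
    unfolding ess_spec_rad_def by (simp add: limI)
  ultimately have "\<forall>\<^sub>F n in sequentially. spec_rad (compress n A) < c"
    using less order_tendstoD(2) by blast
  then show ?thesis using that eventually_happens'[OF sequentially_bot] by blast
qed

lemma path_bound_extend:
  assumes A: "A \<in> nonneg_bdd_mats" and c: "0 < c" "max_cycle_mean A \<le> c" and K: "0 < K"
    and bound: "\<And>k p. (\<And>t. t \<le> k \<Longrightarrow> p t \<notin> insert v S) \<Longrightarrow> path_weight A k p \<le> K * c ^ k"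
  obtains K' where "0 < K'"
    "\<And>k p. (\<And>t. t \<le> k \<Longrightarrow> p t \<notin> S) \<Longrightarrow> path_weight A k p \<le> K' * c ^ k"
proof
  \<comment> \<open>\<open>L\<close> absorbs the one step into or out of \<open>v\<close>: its entry
    is at most \<open>mat_norm A\<close>, and dividing by \<open>c\<close> pays for the extra power.
    The 1 serves empty end pieces.\<close>
  define L where "L = max 1 (K * mat_norm A / c)"
  have L1: "1 \<le> L" by (simp add: L_def)
  have step: "K * c ^ k * mat_norm A \<le> L * c ^ Suc k" for k
  proof -
    have "K * c ^ k * mat_norm A = (K * mat_norm A / c) * c ^ Suc k" using c by simp
    also have "\<dots> \<le> L * c ^ Suc k" by (intro mult_right_mono) (use c in \<open>auto simp: L_def\<close>)
    finally show ?thesis .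
  qed
  \<comment> \<open>\<open>K\<close> serves walks that miss \<open>v\<close>; the two factors
    \<open>L\<close> come from the pieces before the first and after the last visit.\<close>
  show "0 < K + L * L" using K L1 by (intro add_pos_nonneg) auto
  show "path_weight A k p \<le> (K + L * L) * c ^ k" if S: "\<And>t. t \<le> k \<Longrightarrow> p t \<notin> S" for k p
  proof (cases "\<exists>t\<le>k. p t = v")
    case False
    then have "path_weight A k p \<le> K * c ^ k" using S by (intro bound) auto
    also have "\<dots> \<le> (K + L * L) * c ^ k"
      by (intro mult_right_mono) (use L1 c in auto)
    finally show ?thesis .
  next
    case True
    let ?V = "{t. t \<le> k \<and> p t = v}"
    have fin: "finite ?V" and ne: "?V \<noteq> {}" using True by auto
    define a where "a = Min ?V"
    define b where "b = Max ?V"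
    have a: "a \<le> k" "p a = v" using Min_in[OF fin ne] by (auto simp: a_def)
    have b: "b \<le> k" "p b = v" using Max_in[OF fin ne] by (auto simp: b_def)
    have ab: "a \<le> b" using a b by (auto simp: a_def intro: Min_le)
    have first: "a \<le> t" if "t \<le> k" "p t = v" for t
      using that by (auto simp: a_def intro: Min_le)
    have last: "t \<le> b" if "t \<le> k" "p t = v" for t
      using that by (auto simp: b_def intro: Max_ge)
    have before: "path_weight A a p \<le> L * c ^ a"
    proof (cases a)
      case 0
      then show ?thesis using L1 by simp
    next
      case (Suc d)
      \<comment> \<open>The indices \<open>p 0\<close> to \<open>p d\<close> precede the first
        visit, so \<open>bound\<close> applies to them; the step from \<open>p d\<close> enters
        \<open>v\<close>.\<close>
      have "path_weight A a p = path_weight A d p * A (p a) (p d)"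
        using path_weight_add[of A d 1 p] Suc by simp
      also have "\<dots> \<le> (K * c ^ d) * mat_norm A"
      proof (intro mult_mono bound mat_norm_upper A)
        show "p t \<notin> insert v S" if "t \<le> d" for t
          using first[of t] S[of t] that Suc a by auto
      qed (use K c mat_nonneg[OF A] in auto)
      also have "\<dots> \<le> L * c ^ a" using step[of d] Suc by simp
      finally show ?thesis .
    qed
    have middle: "path_weight A (b - a) (\<lambda>t. p (a + t)) \<le> c ^ (b - a)"
      by (rule closed_path_le_power) (use A a b ab c in auto)
    have after: "path_weight A (k - b) (\<lambda>t. p (b + t)) \<le> L * c ^ (k - b)"
    proof (cases "k - b")
      case 0
      then show ?thesis using L1 by simp
    next
      case (Suc d)
      \<comment> \<open>Symmetrically, the first step leaves \<open>v\<close>, and the remaining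
        \<open>d\<close> steps never return.\<close>
      have "path_weight A (k - b) (\<lambda>t. p (b + t))
          = A (p (Suc b)) (p b) * path_weight A d (\<lambda>t. p (b + (1 + t)))"
        using path_weight_add[of A 1 d "\<lambda>t. p (b + t)"] Suc by simp
      also have "\<dots> \<le> mat_norm A * (K * c ^ d)"
      proof (intro mult_mono bound mat_norm_upper A)
        show "p (b + (1 + t)) \<notin> insert v S" if "t \<le> d" for t
        proof -
          have "b + (1 + t) \<le> k" using that Suc by linarith
          then show ?thesis using last[of "b + (1 + t)"] S[of "b + (1 + t)"] by auto
        qed
      qed (use mat_norm_nonneg[OF A] path_weight_nonneg[OF A] in auto)
      also have "\<dots> \<le> L * c ^ (k - b)" using step[of d] Suc by (simp add: mult.commute)
      finally show ?thesis .
    qed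
    have "path_weight A k p = path_weight A a p * path_weight A (b - a) (\<lambda>t. p (a + t))
        * path_weight A (k - b) (\<lambda>t. p (b + t))"
      using path_weight_add[of A b "k - b" p] path_weight_add[of A a "b - a" p] ab b by simp
    also have "\<dots> \<le> (L * c ^ a) * c ^ (b - a) * (L * c ^ (k - b))"
      by (intro mult_mono before middle after mult_nonneg_nonneg path_weight_nonneg A)
        (use L1 c in auto)
    also have "\<dots> = L * L * (c ^ a * c ^ (b - a) * c ^ (k - b))" by simp
    also have "c ^ a * c ^ (b - a) * c ^ (k - b) = c ^ k"
      using ab b by (simp flip: power_add)
    also have "L * L * c ^ k \<le> (K + L * L) * c ^ k"
      by (intro mult_right_mono) (use K c in auto)
    finally show ?thesis .
  qed
qed

text \<open>The set of forbidden indices shrinks from \<open>{..<n}\<close> to the empty set, one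
  index at a time; the constant may grow at each stage while the rate \<open>c\<close>
  stays.\<close>

lemma spec_rad_le_of_compress:
  assumes A: "A \<in> nonneg_bdd_mats"
    and c: "spec_rad (compress n A) < c" "max_cycle_mean A \<le> c"
  shows "spec_rad A \<le> c"
proof -
  have c0: "0 < c" using c spec_rad_nonneg[OF compress_nonneg_bdd[OF A, of n]] by linarith
  obtain K where K: "0 < K" "\<And>k p. path_weight (compress n A) k p \<le> K * c ^ k"
    using spec_rad_less_boundE[OF compress_nonneg_bdd[OF A] c(1)] by blast
  have "\<exists>K>0. \<forall>k p. (\<forall>t\<le>k. p t \<notin> {..<n - m}) \<longrightarrow> path_weight A k p \<le> K * c ^ k" for m
  proof (induction m)
    case 0
    \<comment> \<open>A walk that stays on indices at least \<open>n\<close> meets only entries that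
      \<open>compress n\<close> leaves unchanged.\<close>
    have "path_weight A k p = path_weight (compress n A) k p" if "\<forall>t\<le>k. p t \<notin> {..<n}" for k p
      unfolding path_weight_def compress_def
      by (intro prod.cong) (use that in \<open>auto simp: Suc_le_eq\<close>)
    then show ?case using K by (auto intro!: exI[of _ K])
  next
    case (Suc m)
    show ?case
    proof (cases "m < n")
      case True
      then have S: "{..<n - m} = insert (n - Suc m) {..<n - Suc m}"
        by (auto simp flip: lessThan_Suc simp: Suc_diff_Suc)
      from Suc.IH obtain K1 where K1: "0 < K1"
        "\<And>k p. (\<And>t. t \<le> k \<Longrightarrow> p t \<notin> insert (n - Suc m) {..<n - Suc m})
          \<Longrightarrow> path_weight A k p \<le> K1 * c ^ k"
        unfolding S by blast
      show ?thesis using path_bound_extend[OF A c0 c(2) K1] by metis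
    \<comment> \<open>For \<open>n \<le> m\<close> truncated subtraction makes both sets
      empty.\<close>
    qed (use Suc.IH in simp)
  qed
  from this[of n] obtain K' where "0 < K'" "\<And>k p. path_weight A k p \<le> K' * c ^ k" by auto
  then show ?thesis using spec_rad_le_of_bound[OF A] c0 by (meson less_imp_le)
qed

lemma max_cycle_mean_eq_spec_rad:
  assumes A: "A \<in> nonneg_bdd_mats" and ess: "ess_spec_rad A < spec_rad A"
  shows "max_cycle_mean A = spec_rad A"
proof (rule antisym[OF max_cycle_mean_le_spec_rad[OF A]], rule ccontr)
  assume "\<not> spec_rad A \<le> max_cycle_mean A"
  then obtain c where c: "max (ess_spec_rad A) (max_cycle_mean A) < c" "c < spec_rad A"
    using ess dense[of "max (ess_spec_rad A) (max_cycle_mean A)" "spec_rad A"] by auto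
  obtain n where "spec_rad (compress n A) < c"
    using ess_spec_rad_lessE[OF A, of c] c by auto
  then show False using spec_rad_le_of_compress[OF A, of n c] c by auto
qed

section \<open>Semicontinuity\<close>

text \<open>\<open>atin\<close> sees only points of the space, so results about non-negative bounded
  matrices apply along this filter.\<close>

lemma eventually_atin_nonneg_bdd: "\<forall>\<^sub>F B in atin mat_topology A. B \<in> nonneg_bdd_mats"
  unfolding eventually_atin
  by (metis DiffD1 openin_topspace topspace_mat_topology)

lemma mat_dist_tendsto:
  assumes A: "A \<in> nonneg_bdd_mats"
  shows "(mat_dist A \<longlongrightarrow> 0) (atin mat_topology A)"
proof -
  interpret Metric_space nonneg_bdd_mats mat_dist by (rule Metric_space_nonneg_bdd_mats)
  show ?thesis
  proof (rule order_tendstoI)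
    fix e :: real assume "0 < e"
    then show "\<forall>\<^sub>F B in atin mat_topology A. mat_dist A B < e"
      unfolding mat_topology_def eventually_atin_metric
      using A by (auto simp: commute intro!: exI[of _ e])
  \<comment> \<open>The bound from below holds for all \<open>B\<close>, since
    \<open>mat_dist\<close> is 0 off the carrier.\<close>
  qed (auto intro!: always_eventually less_le_trans[OF _ nonneg])
qed

lemma entry_tendsto:
  assumes A: "A \<in> nonneg_bdd_mats"
  shows "((\<lambda>B. B i j) \<longlongrightarrow> A i j) (atin mat_topology A)"
proof (rule Lim_transform_bound[THEN Lim_null[THEN iffD2]])
  show "(mat_dist A \<longlongrightarrow> 0) (atin mat_topology A)" by (rule mat_dist_tendsto[OF A])
  show "\<forall>\<^sub>F B in atin mat_topology A. norm (B i j - A i j) \<le> norm (mat_dist A B)"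
    using eventually_atin_nonneg_bdd
  proof eventually_elim
    case (elim B)
    show ?case using mat_dist_upper[OF A elim, of i j] by (simp add: abs_minus_commute)
  qed
qed

text \<open>Expand the product and replace \<open>a t\<close> by \<open>C\<close> in every term
  containing a factor \<open>d\<close>. The resulting error does not depend on
  \<open>a\<close>.\<close>

lemma prod_add_le:
  fixes a :: "nat \<Rightarrow> real"
  assumes a: "\<And>t. 0 \<le> a t" "\<And>t. a t \<le> C" and d: "0 \<le> d"
  shows "(\<Prod>t<m. a t + d) \<le> (\<Prod>t<m. a t) + ((C + d) ^ m - C ^ m)"
proof (induction m)
  case (Suc m)
  let ?P = "\<Prod>t<m. a t" and ?D = "(C + d) ^ m - C ^ m"
  have C: "0 \<le> C" using a order_trans by blast
  have P: "?P \<le> C ^ m" using prod_mono[of "{..<m}" a "\<lambda>_. C"] a by simp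
  have D: "0 \<le> ?D" using C d by (simp add: power_mono)
  have "(\<Prod>t<Suc m. a t + d) \<le> (?P + ?D) * (a m + d)"
    using Suc.IH a d by (simp add: mult_right_mono)
  also have "\<dots> = ?P * a m + ?P * d + ?D * (a m + d)" by (simp add: algebra_simps)
  also have "\<dots> \<le> ?P * a m + C ^ m * d + ?D * (C + d)"
    by (intro add_mono mult_left_mono mult_right_mono P) (use a d D in auto)
  also have "\<dots> = (\<Prod>t<Suc m. a t) + ((C + d) ^ Suc m - C ^ Suc m)"
    by (simp add: algebra_simps)
  finally show ?case .
qed simp

text \<open>The error is the same for all walks, so it survives the supremum over infinitely many of
  them; entrywise convergence would not give this.\<close>

lemma norm_max_pow_perturb:
  assumes A: "A \<in> nonneg_bdd_mats" and B: "B \<in> nonneg_bdd_mats"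
  shows "mat_norm (max_pow B m)
    \<le> mat_norm (max_pow A m) + ((mat_norm A + mat_dist A B) ^ m - mat_norm A ^ m)"
proof (rule norm_max_pow_le[OF B])
  fix p
  have "path_weight B m p \<le> (\<Prod>t<m. A (p (Suc t)) (p t) + mat_dist A B)"
    unfolding path_weight_def
  proof (intro prod_mono conjI mat_nonneg B)
    show "B (p (Suc t)) (p t) \<le> A (p (Suc t)) (p t) + mat_dist A B" for t
      using mat_dist_upper[OF A B, of "p (Suc t)" "p t"] by linarith
  qed
  also have "\<dots> \<le> path_weight A m p + ((mat_norm A + mat_dist A B) ^ m - mat_norm A ^ m)"
    unfolding path_weight_def
    by (intro prod_add_le mat_nonneg mat_norm_upper A
        Metric_space.nonneg[OF Metric_space_nonneg_bdd_mats])
  also have "path_weight A m p \<le> mat_norm (max_pow A m)" by (rule path_weight_le_norm[OF A])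
  finally show "path_weight B m p
    \<le> mat_norm (max_pow A m) + ((mat_norm A + mat_dist A B) ^ m - mat_norm A ^ m)" by simp
qed

lemma spec_rad_upper_semicontinuous:
  assumes A: "A \<in> nonneg_bdd_mats" and a: "spec_rad A < a"
  shows "\<forall>\<^sub>F B in atin mat_topology A. spec_rad B < a"
proof -
  \<comment> \<open>\<open>spec_rad_le\<close> yields only a weak inequality; the intermediate
    \<open>x\<close> restores strictness.\<close>
  obtain x where x: "spec_rad A < x" "x < a" using dense[OF a] by blast
  have x0: "0 \<le> x" using spec_rad_nonneg[OF A] x by linarith
  obtain m where m: "0 < m" "mat_norm (max_pow A m) < x ^ m"
    using spec_rad_lessE[OF A x(1)] .
  have "((\<lambda>B. mat_norm (max_pow A m) + ((mat_norm A + mat_dist A B) ^ m - mat_norm A ^ m))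
      \<longlongrightarrow> mat_norm (max_pow A m) + ((mat_norm A + 0) ^ m - mat_norm A ^ m)) (atin mat_topology A)"
    by (intro tendsto_intros mat_dist_tendsto A)
  then have "\<forall>\<^sub>F B in atin mat_topology A.
      mat_norm (max_pow A m) + ((mat_norm A + mat_dist A B) ^ m - mat_norm A ^ m) < x ^ m"
    by (rule order_tendstoD) (use m in simp)
  then show ?thesis using eventually_atin_nonneg_bdd
  proof eventually_elim
    case (elim B)
    have "mat_norm (max_pow B m) \<le> x ^ m"
      using norm_max_pow_perturb[OF A elim(2), of m] elim(1) by linarith
    then show ?case using spec_rad_le[OF elim(2) m(1) x0] x by linarith
  qed
qed

text \<open>One closed walk of \<open>A\<close> with mean above \<open>a\<close> is enough. Its
  weight involves finitely many entries, so entrywise convergence keeps its mean above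
  \<open>a\<close> for nearby matrices.\<close>

lemma max_cycle_mean_lower_semicontinuous:
  assumes A: "A \<in> nonneg_bdd_mats" and a: "a < max_cycle_mean A"
  shows "\<forall>\<^sub>F B in atin mat_topology A. a < max_cycle_mean B"
proof -
  obtain k p where k: "0 < k" "p k = p 0" "a < root k (path_weight A k p)"
    using less_max_cycle_meanE[OF assms] .
  have "((\<lambda>B. root k (path_weight B k p)) \<longlongrightarrow> root k (path_weight A k p)) (atin mat_topology A)"
    unfolding path_weight_def by (intro tendsto_real_root tendsto_prod entry_tendsto A)
  then have "\<forall>\<^sub>F B in atin mat_topology A. a < root k (path_weight B k p)"
    by (rule order_tendstoD) (rule k)
  then show ?thesis using eventually_atin_nonneg_bdd
    by eventually_elim (use max_cycle_mean_upper k less_le_trans in blast)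
qed

theorem corollary5p9:
  fixes A :: inf_mat
  assumes "A \<in> nonneg_bdd_mats"
    and "ess_spec_rad A < spec_rad A"
  shows "topcontinuous_at mat_topology euclideanreal spec_rad A
    \<and> topcontinuous_at mat_topology euclideanreal max_cycle_mean A"
proof -
  let ?F = "atin mat_topology A"
  note eq = max_cycle_mean_eq_spec_rad[OF assms]
  have le: "\<forall>\<^sub>F B in ?F. max_cycle_mean B \<le> spec_rad B"
    using eventually_atin_nonneg_bdd by eventually_elim (rule max_cycle_mean_le_spec_rad)
  have upper: "\<forall>\<^sub>F B in ?F. spec_rad B < a" if "spec_rad A < a" for a
    using spec_rad_upper_semicontinuous[OF assms(1) that] .
  have lower: "\<forall>\<^sub>F B in ?F. a < max_cycle_mean B" if "a < max_cycle_mean A" for a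
    using max_cycle_mean_lower_semicontinuous[OF assms(1) that] .
  have "(spec_rad \<longlongrightarrow> spec_rad A) ?F"
  proof (rule order_tendstoI)
    show "\<forall>\<^sub>F B in ?F. a < spec_rad B" if "a < spec_rad A" for a
      \<comment> \<open>The equality at \<open>A\<close> turns the lower bound for
        \<open>max_cycle_mean\<close> nearby into one for \<open>spec_rad\<close>; the upper bound
        is transferred the other way below.\<close>
      using lower[of a] that eq le by (auto elim: eventually_elim2)
  qed (rule upper)
  moreover have "(max_cycle_mean \<longlongrightarrow> max_cycle_mean A) ?F"
  proof (rule order_tendstoI)
    show "\<forall>\<^sub>F B in ?F. max_cycle_mean B < a" if "max_cycle_mean A < a" for a
      using upper[of a] that eq le by (auto elim: eventually_elim2)
  qed (rule lower)
  ultimately show ?thesis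
    using assms(1) by (simp add: topcontinuous_at_atin)
qed

end
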